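(* Let $X$ be a treatment variable with $m$ values $x_1,\dots,x_m$ and $Y$ an effect variable with $n$ values $y_1,\dots,y_n$ in a structural causal model. Let $1\le i\le n$ and $1\le j,k\le m$ with $j\ne k$. Then $$\max\{0,\ P(Y_{x_j}=y_i)-P(X=x_j,Y=y_i)-1+P(X=x_j)+P(X=x_k)\}\ \le\ P(Y_{x_j}=y_i,\,X=x_k)$$ and $$P(Y_{x_j}=y_i,\,X=x_k)\ \le\ \min\{P(Y_{x_j}=y_i)-P(X=x_j,Y=y_i),\ P(X=x_k)\}.$$
   Context: $Y_{x_j}$ denotes the counterfactual (potential outcome) variable "the value $Y$ would have, had $X$ been $x_j$". The structural causal model induces one probability space $P$ on which $X$, $Y$, and $Y_{x_1},\dots,Y_{x_m}$ (each with values in $\{y_1,\dots,y_n\}$) are jointly defined, and they satisfy consistency: on the event $X=x_j$ one has $Y_{x_j}=Y$ (so $P(Y_{x_j}=y_i,X=x_j)=P(X=x_j,Y=y_i)$). The values $x_1,\dots,x_m$ are distinct, as are $y_1,\dots,y_n$. *)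

theory Defs
  imports "HOL-Probability.Probability"
begin

text \<open>
  The probability space induced by a structural causal model on a treatment \<open>X\<close>, an effect \<open>Y\<close>
  and the counterfactuals \<open>Y\<^sub>a\<close>, written \<open>Ycf a\<close> (``the value \<open>Y\<close> would have, had \<open>X\<close> been
  \<open>a\<close>''). Sample points are the values of the exogenous variables, so consistency holds at
  every point rather than almost surely. Nothing is assumed about \<open>Ycf a\<close> when \<open>a\<close> is not one
  of \<open>x 1, \<dots>, x m\<close>.
\<close>

locale counterfactual_model = prob_space M
  for M :: "'w measure" +
  fixes m :: nat and x :: "nat \<Rightarrow> 'a"
    and n :: nat and y :: "nat \<Rightarrow> 'b"
    and X :: "'w \<Rightarrow> 'a" and Y :: "'w \<Rightarrow> 'b"
    and Ycf :: "'a \<Rightarrow> 'w \<Rightarrow> 'b"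
  assumes distinct_x: "inj_on x {1..m}"
    and distinct_y: "inj_on y {1..n}"
    and treatment: "random_variable (count_space (x ` {1..m})) X"
    and effect: "random_variable (count_space (y ` {1..n})) Y"
    and counterfactual:
      "\<And>j. j \<in> {1..m} \<Longrightarrow> random_variable (count_space (y ` {1..n})) (Ycf (x j))"
    and consistency:
      "\<And>j \<omega>. j \<in> {1..m} \<Longrightarrow> \<omega> \<in> space M \<Longrightarrow> X \<omega> = x j \<Longrightarrow> Ycf (x j) \<omega> = Y \<omega>"

end

theory Submission
  imports Defs
begin

text \<open>Write \<open>A\<close>, \<open>B\<close>, \<open>C\<close> for the events
  \<open>Ycf (x j) = y i\<close>, \<open>X = x j\<close>, \<open>X = x k\<close>. Consistency
  identifies the observational event \<open>X = x j \<and> Y = y i\<close> with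
  \<open>A \<inter> B\<close>, so the claim becomes a Frechet-type bound for
  \<open>A \<inter> C\<close>. As \<open>B\<close> and \<open>C\<close> are disjoint,
  \<open>A \<inter> C\<close> lies in \<open>A - B\<close>, which gives the upper bound. Conversely,
  \<open>A - B\<close> is covered by \<open>A \<inter> C\<close> and the complement of
  \<open>B \<union> C\<close>, whose probability is 1 - P(B) - P(C); this gives the lower
  bound.\<close>

theorem theorem6:
  fixes M :: "'w measure"
    and m n i j k :: nat
    and x :: "nat \<Rightarrow> 'a" and y :: "nat \<Rightarrow> 'b"
    and X :: "'w \<Rightarrow> 'a" and Y :: "'w \<Rightarrow> 'b"
    and Ycf :: "'a \<Rightarrow> 'w \<Rightarrow> 'b"
  assumes "counterfactual_model M m x n y X Y Ycf"
    and "1 \<le> i" "i \<le> n"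
    and "1 \<le> j" "j \<le> m"
    and "1 \<le> k" "k \<le> m"
    and "j \<noteq> k"
  shows "max 0 (\<P>(\<omega> in M. Ycf (x j) \<omega> = y i) - \<P>(\<omega> in M. X \<omega> = x j \<and> Y \<omega> = y i) - 1
             + \<P>(\<omega> in M. X \<omega> = x j) + \<P>(\<omega> in M. X \<omega> = x k))
           \<le> \<P>(\<omega> in M. Ycf (x j) \<omega> = y i \<and> X \<omega> = x k)
       \<and> \<P>(\<omega> in M. Ycf (x j) \<omega> = y i \<and> X \<omega> = x k)
           \<le> min (\<P>(\<omega> in M. Ycf (x j) \<omega> = y i) - \<P>(\<omega> in M. X \<omega> = x j \<and> Y \<omega> = y i))
                 (\<P>(\<omega> in M. X \<omega> = x k))"
proof -
  interpret counterfactual_model M m x n y X Y Ycf by fact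
  define A where "A = {\<omega> \<in> space M. Ycf (x j) \<omega> = y i}"
  define B where "B = {\<omega> \<in> space M. X \<omega> = x j}"
  define C where "C = {\<omega> \<in> space M. X \<omega> = x k}"
  have j: "j \<in> {1..m}" and k: "k \<in> {1..m}" and i: "i \<in> {1..n}"
    using assms by auto
  \<comment> \<open>A singleton is measurable in \<open>count_space\<close> when its point lies in
    the carrier, hence the use of the index ranges here and for \<open>B\<close> and
    \<open>C\<close>.\<close>
  have A: "A \<in> events"
    using measurable_sets[OF counterfactual[OF j], of "{y i}"] i
    by (simp add: A_def vimage_def Int_def conj_commute)
  have B: "B \<in> events" and C: "C \<in> events"
    using measurable_sets[OF treatment, of "{x j}"] measurable_sets[OF treatment, of "{x k}"] j k
    by (simp_all add: B_def C_def vimage_def Int_def conj_commute)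
  have "x j \<noteq> x k"
    using inj_onD[OF distinct_x _ j k] \<open>j \<noteq> k\<close> by blast
  then have BC: "B \<inter> C = {}"
    by (auto simp: B_def C_def)
  \<comment> \<open>Consistency holds at every sample point, so this is an equality of sets, not
    merely of probabilities.\<close>
  have AB: "{\<omega> \<in> space M. X \<omega> = x j \<and> Y \<omega> = y i} = A \<inter> B"
    using consistency[OF j] by (auto simp: A_def B_def)
  have AC: "{\<omega> \<in> space M. Ycf (x j) \<omega> = y i \<and> X \<omega> = x k} = A \<inter> C"
    by (auto simp: A_def C_def)
  have union: "prob (A \<inter> B \<union> A \<inter> C) = prob (A \<inter> B) + prob (A \<inter> C)"
    using A B C BC by (intro finite_measure_Union) auto
  have "prob (A \<inter> B \<union> A \<inter> C) \<le> prob A"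
    using A by (intro finite_measure_mono) auto
  with union have upper: "prob (A \<inter> C) \<le> prob A - prob (A \<inter> B)"
    by simp
  \<comment> \<open>The part of \<open>A\<close> outside \<open>B \<union> C\<close> is bounded
    crudely by the whole complement of \<open>B \<union> C\<close>.\<close>
  have "prob A \<le> prob (A \<inter> B \<union> A \<inter> C \<union> (space M - (B \<union> C)))"
    using A B C by (intro finite_measure_mono) (auto simp: A_def)
  also have "\<dots> \<le> prob (A \<inter> B \<union> A \<inter> C) + prob (space M - (B \<union> C))"
    using A B C by (intro measure_Un_le) auto
  also have "prob (space M - (B \<union> C)) = 1 - (prob B + prob C)"
    using B C BC by (simp add: prob_compl finite_measure_Union)
  finally have lower: "prob A - prob (A \<inter> B) - 1 + prob B + prob C \<le> prob (A \<inter> C)"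
    using union by simp
  have "prob (A \<inter> C) \<le> prob C"
    using C by (intro finite_measure_mono) auto
  \<comment> \<open>The bound by 0 inside \<open>max\<close> is nonnegativity of the
    measure.\<close>
  with lower upper show ?thesis
    unfolding AB AC A_def[symmetric] B_def[symmetric] C_def[symmetric] by simp
qed

end
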